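(* For every integer $n \geq 15$, $\frac{3}{2}n-\frac{5}{2} \leq rsat(n,C_5) \leq 2n-6$.
   Context: All graphs are finite, simple and undirected. An edge-coloring of a graph $G$ is a function $\mathcal{C}:E(G)\to\mathbb{N}$; a (sub)graph is rainbow if all its edges have distinct colors. Given a graph $F$, an edge-colored graph $G$ is $F$-rainbow free if it contains no rainbow copy of $F$, and it is $F$-rainbow saturated if it is $F$-rainbow free but adding any nonedge of $G$ with any color on it creates a rainbow copy of $F$. The rainbow saturation number $rsat(n,F)$ is the minimum number of edges of a graph $G$ on $n$ vertices for which some edge-coloring makes $G$ $F$-rainbow saturated. $C_r$ denotes the cycle on $r$ vertices. *)

theory Defs
  imports Complex_Main
begin

type_synonym 'a graph = "'a set \<times> 'a set set"

abbreviation verts :: "'a graph \<Rightarrow> 'a set" where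
  "verts \<equiv> fst"

abbreviation edges :: "'a graph \<Rightarrow> 'a set set" where
  "edges \<equiv> snd"

definition simple_graph :: "'a graph \<Rightarrow> bool" where
  "simple_graph G \<longleftrightarrow>
     finite (verts G) \<and> (\<forall>e \<in> edges G. e \<subseteq> verts G \<and> card e = 2)"

definition subgraph :: "'a graph \<Rightarrow> 'a graph \<Rightarrow> bool" where
  "subgraph H G \<longleftrightarrow> simple_graph H \<and> verts H \<subseteq> verts G \<and> edges H \<subseteq> edges G"

definition isomorphic :: "'a graph \<Rightarrow> 'b graph \<Rightarrow> bool" where
  "isomorphic F H \<longleftrightarrow>
     (\<exists>f. bij_betw f (verts F) (verts H) \<and> edges H = (\<lambda>e. f ` e) ` edges F)"

definition nonedges :: "'a graph \<Rightarrow> 'a set set" where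
  "nonedges G = {e. e \<subseteq> verts G \<and> card e = 2 \<and> e \<notin> edges G}"

definition add_edge :: "'a graph \<Rightarrow> 'a set \<Rightarrow> 'a graph" where
  "add_edge G e = (verts G, insert e (edges G))"

text \<open>Edge-colorings are total functions on vertex sets; only their values on the edges of
  the graph at hand are ever inspected. Colorings need not be proper.\<close>

type_synonym 'a coloring = "'a set \<Rightarrow> nat"

definition rainbow :: "'a graph \<Rightarrow> 'a coloring \<Rightarrow> bool" where
  "rainbow H c \<longleftrightarrow> inj_on c (edges H)"

definition has_rainbow_copy :: "'b graph \<Rightarrow> 'a graph \<Rightarrow> 'a coloring \<Rightarrow> bool" where
  "has_rainbow_copy F G c \<longleftrightarrow> (\<exists>H. subgraph H G \<and> isomorphic F H \<and> rainbow H c)"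

definition rainbow_free :: "'b graph \<Rightarrow> 'a graph \<Rightarrow> 'a coloring \<Rightarrow> bool" where
  "rainbow_free F G c \<longleftrightarrow> \<not> has_rainbow_copy F G c"

text \<open>The color \<open>k\<close> of the added edge is arbitrary: it may or may not already occur in \<open>G\<close>.\<close>

definition rainbow_saturated :: "'b graph \<Rightarrow> 'a graph \<Rightarrow> 'a coloring \<Rightarrow> bool" where
  "rainbow_saturated F G c \<longleftrightarrow>
     rainbow_free F G c \<and>
     (\<forall>e \<in> nonedges G. \<forall>k. has_rainbow_copy F (add_edge G e) (c(e := k)))"

text \<open>Every finite graph is isomorphic to one whose vertices are natural numbers, so fixing
  the vertex type loses no generality. The minimum is over a nonempty set whenever \<open>F\<close> has at
  least two edges, see \<open>rsat_attained\<close> below.\<close>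

definition rsat :: "nat \<Rightarrow> 'b graph \<Rightarrow> nat" where
  "rsat n F =
     (LEAST m. \<exists>(G :: nat graph) c.
        simple_graph G \<and> card (verts G) = n \<and> card (edges G) = m \<and> rainbow_saturated F G c)"

text \<open>The cycle on \<open>r\<close> vertices; meaningful for \<open>r \<ge> 3\<close> only.\<close>

definition cycle :: "nat \<Rightarrow> nat graph" where
  "cycle r = ({..<r}, {{i, (i + 1) mod r} | i. i < r})"

lemma rsat_attained:
  fixes F :: "'b graph"
  assumes "e1 \<in> edges F" "e2 \<in> edges F" "e1 \<noteq> e2" and F: "simple_graph F"
  shows "\<exists>(G :: nat graph) c. simple_graph G \<and> card (verts G) = n \<and>
           card (edges G) = rsat n F \<and> rainbow_saturated F G c"
proof -
  let ?K = "({..<n}, {e. e \<subseteq> {..<n} \<and> card e = 2}) :: nat graph"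
  have "\<not> has_rainbow_copy F ?K (\<lambda>_. 0)"
  proof
    assume "has_rainbow_copy F ?K (\<lambda>_. 0)"
    then obtain H :: "nat graph" and f where
      f: "bij_betw f (verts F) (verts H)" and EH: "edges H = (\<lambda>e. f ` e) ` edges F"
      and c: "inj_on (\<lambda>_. 0 :: nat) (edges H)"
      unfolding has_rainbow_copy_def isomorphic_def rainbow_def by blast
    have "f ` e1 = f ` e2"
      using c EH assms(1,2) unfolding inj_on_def by blast
    moreover have "e1 \<subseteq> verts F" "e2 \<subseteq> verts F"
      using F assms(1,2) unfolding simple_graph_def by blast+
    ultimately show False
      using f assms(3) by (metis bij_betw_imp_inj_on inj_on_image_eq_iff)
  qed
  then have "rainbow_saturated F ?K (\<lambda>_. 0)"
    by (auto simp: rainbow_saturated_def rainbow_free_def nonedges_def)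
  then have "\<exists>m. \<exists>(G :: nat graph) c. simple_graph G \<and> card (verts G) = n \<and>
      card (edges G) = m \<and> rainbow_saturated F G c"
    by (intro exI[of _ "card (edges ?K)"] exI[of _ ?K] exI[of _ "\<lambda>_. 0"])
      (auto simp: simple_graph_def)
  from LeastI_ex[OF this] show ?thesis
    unfolding rsat_def .
qed

end

theory Submission
  imports Defs
begin

text \<open>Lower bound: saturation forces a path of length 4 that avoids any prescribed color between
  any two nonadjacent vertices. Hence all degrees are at least 2; if some vertex \<open>v\<close> has
  degree 2, arrange the graph in levels by the distance from \<open>v\<close> and its two neighbors, and give
  every edge to its upper end (half to each end if they are on the same level). The paths leaving
  \<open>v\<close> show that the vertices above level 0 get at least 3/2 edges on average, where level 1
  vertices that get only one edge are compensated by level 2 vertices.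

  Upper bound: take a \<open>K\<^sub>4\<close>, hang a triangle on each of three of its vertices and a book (at
  least four triangles with a common edge) with a spine vertex at the fourth one, and color all
  edges differently.\<close>

section \<open>Rainbow pentagons and saturation\<close>

lemma lessThan5: "{..<5::nat} = {0,1,2,3,4}" by auto

lemma cycle5_edges: "edges (cycle 5) = {{0,1},{1,2},{2,3},{3,4},{4,0}}"
proof -
  have "edges (cycle 5) = (\<lambda>i. {i, (i + 1) mod 5}) ` {..<5}"
    unfolding cycle_def snd_conv by blast
  then show ?thesis
    unfolding lessThan5 by (simp add: One_nat_def[symmetric] Suc_1 del: One_nat_def)
qed

lemma simple_graph_cycle5: "simple_graph (cycle 5)"
  unfolding simple_graph_def cycle5_edges by (simp add: cycle_def)

lemma edge_in_verts:
  assumes "simple_graph G" "{a, b} \<in> edges G"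
  shows "a \<in> verts G" "b \<in> verts G" "a \<noteq> b"
  using assms unfolding simple_graph_def by force+

lemma distinct_cycle5_edges:
  "distinct [p, q, r, s, t] \<Longrightarrow> distinct [{p,q},{q,r},{r,s},{s,t},{t,p}]"
  by (auto simp: doubleton_eq_iff)

text \<open>Trades subgraphs and isomorphisms for five vertices in cyclic order. As the five edges
  are pairwise distinct, injectivity of \<open>c\<close> on them becomes distinctness of the list of
  colors.\<close>

lemma has_rainbow_copy_cycle5_iff:
  assumes G: "simple_graph G"
  shows "has_rainbow_copy (cycle 5) G c \<longleftrightarrow>
    (\<exists>p q r s t. distinct [p, q, r, s, t] \<and>
       {{p,q},{q,r},{r,s},{s,t},{t,p}} \<subseteq> edges G \<and>
       distinct (map c [{p,q},{q,r},{r,s},{s,t},{t,p}]))"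
    (is "_ \<longleftrightarrow> ?rhs")
proof
  assume "has_rainbow_copy (cycle 5) G c"
  then obtain H f where H: "subgraph H G" "rainbow H c"
    and f: "bij_betw f {..<5::nat} (verts H)"
    and EH: "edges H = (\<lambda>e. f ` e) ` edges (cycle 5)"
    unfolding has_rainbow_copy_def isomorphic_def by (auto simp: cycle_def)
  have "inj_on f {..<5}"
    using f by (rule bij_betw_imp_inj_on)
  then have ff: "f i \<noteq> f j" if "i < 5" "j < 5" "i \<noteq> j" for i j
    using that by (auto simp: inj_on_def)
  have d: "distinct [f 0, f 1, f 2, f 3, f 4]"
    by (simp add: ff)
  have EH': "edges H = {{f 0,f 1},{f 1,f 2},{f 2,f 3},{f 3,f 4},{f 4,f 0}}"
    unfolding EH cycle5_edges by simp
  have "distinct (map c [{f 0,f 1},{f 1,f 2},{f 2,f 3},{f 3,f 4},{f 4,f 0}])"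
    unfolding distinct_map
    using H(2) distinct_cycle5_edges[OF d] unfolding rainbow_def EH' by simp
  moreover have "edges H \<subseteq> edges G"
    using H(1) unfolding subgraph_def by blast
  ultimately show ?rhs
    using d unfolding EH'
    by (intro exI conjI)
next
  assume ?rhs
  then obtain p q r s t where d: "distinct [p, q, r, s, t]"
    and E: "{{p,q},{q,r},{r,s},{s,t},{t,p}} \<subseteq> edges G"
    and c: "distinct (map c [{p,q},{q,r},{r,s},{s,t},{t,p}])"
    by (elim exE conjE) (rule that)
  define H where "H = ({p,q,r,s,t}, {{p,q},{q,r},{r,s},{s,t},{t,p}})"
  define f where "f i = [p,q,r,s,t] ! i" for i
  have f: "f 0 = p" "f 1 = q" "f 2 = r" "f 3 = s" "f 4 = t"
    by (simp_all add: f_def)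
  have "bij_betw f {0,1,2,3,4} {p,q,r,s,t}"
    unfolding bij_betw_def using d by (simp add: f del: One_nat_def)
  then have "bij_betw f (verts (cycle 5)) (verts H)"
    unfolding cycle_def H_def by (simp only: fst_conv lessThan5)
  moreover have "edges H = (\<lambda>e. f ` e) ` edges (cycle 5)"
    unfolding cycle5_edges by (simp add: H_def f del: One_nat_def)
  moreover have "{p, q, r, s, t} \<subseteq> verts G"
    using E by (auto dest: edge_in_verts(1)[OF G])
  then have "subgraph H G"
    using E d unfolding subgraph_def simple_graph_def H_def by auto
  moreover have "rainbow H c"
    using c unfolding rainbow_def H_def distinct_map snd_conv list.set by (elim conjE)
  ultimately show "has_rainbow_copy (cycle 5) G c"
    unfolding has_rainbow_copy_def isomorphic_def by (intro exI conjI)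
qed

lemma simple_graph_add_edge:
  assumes "simple_graph G" "e \<in> nonedges G"
  shows "simple_graph (add_edge G e)"
  using assms unfolding simple_graph_def add_edge_def nonedges_def by auto

text \<open>A rainbow pentagon created by the new edge must use it, for \<open>G\<close> is rainbow
  free; removing it leaves a path of length 4. Since the new edge has color \<open>k\<close>, the
  path avoids \<open>k\<close>.\<close>

lemma rainbow_saturated_cycle5_path:
  assumes G: "simple_graph G" and sat: "rainbow_saturated (cycle 5) G c"
    and uv: "u \<in> verts G" "v \<in> verts G" "u \<noteq> v" "{u, v} \<notin> edges G"
  shows "\<exists>p q r. distinct [u, p, q, r, v] \<and> {{u,p},{p,q},{q,r},{r,v}} \<subseteq> edges G \<and>
    k \<notin> c ` {{u,p},{p,q},{q,r},{r,v}}"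
proof -
  let ?e = "{u, v}" and ?c = "c({u,v} := k)"
  define Q where "Q p q r s t \<longleftrightarrow> distinct [p, q, r, s, t] \<and>
       {{p,q},{q,r},{r,s},{s,t},{t,p}} \<subseteq> insert ?e (edges G) \<and>
       distinct (map ?c [{p,q},{q,r},{r,s},{s,t},{t,p}])" for p q r s t
  have e: "?e \<in> nonedges G"
    using uv by (simp add: nonedges_def)
  then have "has_rainbow_copy (cycle 5) (add_edge G ?e) ?c"
    using sat unfolding rainbow_saturated_def by simp
  then have "\<exists>p q r s t. Q p q r s t"
    unfolding has_rainbow_copy_cycle5_iff[OF simple_graph_add_edge[OF G e]] Q_def
    by (simp only: add_edge_def snd_conv)
  then obtain p q r s t where Q: "Q p q r s t"
    by blast
  \<comment> \<open>Rotation moves the new edge to the closing position \<open>{t, p}\<close>,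
    wherever it lies on the pentagon.\<close>
  have rot: "Q q r s t p" if "Q p q r s t" for p q r s t
    using that distinct1_rotate[of "[p,q,r,s,t]"]
      distinct1_rotate[of "map ?c [{p,q},{q,r},{r,s},{s,t},{t,p}]"]
    unfolding Q_def by (simp only: rotate1.simps list.map append.simps insert_subset)
  have free: "\<not> has_rainbow_copy (cycle 5) G c"
    using sat unfolding rainbow_saturated_def rainbow_free_def by simp
  have "?e \<in> {{p,q},{q,r},{r,s},{s,t},{t,p}}"
  proof (rule ccontr)
    assume n: "?e \<notin> {{p,q},{q,r},{r,s},{s,t},{t,p}}"
    then have "distinct (map c [{p,q},{q,r},{r,s},{s,t},{t,p}])"
      using Q map_fun_upd[of ?e "[{p,q},{q,r},{r,s},{s,t},{t,p}]" c k]
      unfolding Q_def by (simp only: list.set simp_thms)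
    moreover have "{{p,q},{q,r},{r,s},{s,t},{t,p}} \<subseteq> edges G"
      using Q unfolding Q_def by (simp only: subset_insert[OF n])
    moreover have "distinct [p, q, r, s, t]"
      using Q unfolding Q_def by (elim conjE)
    ultimately have "has_rainbow_copy (cycle 5) G c"
      unfolding has_rainbow_copy_cycle5_iff[OF G] by (intro exI conjI)
    then show False
      using free by contradiction
  qed
  then have "\<exists>p q r s t. Q p q r s t \<and> ?e = {t, p}"
  proof (elim insertE emptyE)
    assume "?e = {p,q}"
    then show ?thesis by (intro exI conjI) (rule rot[OF Q])
  next
    assume "?e = {q,r}"
    then show ?thesis by (intro exI conjI) (rule rot[OF rot[OF Q]])
  next
    assume "?e = {r,s}"
    then show ?thesis by (intro exI conjI) (rule rot[OF rot[OF rot[OF Q]]])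
  next
    assume "?e = {s,t}"
    then show ?thesis by (intro exI conjI) (rule rot[OF rot[OF rot[OF rot[OF Q]]]])
  next
    assume "?e = {t,p}"
    then show ?thesis by (intro exI conjI) (rule Q)
  qed
  then obtain p q r s t where Q: "Q p q r s t" and tp: "?e = {t, p}"
    by blast
  have d: "distinct [p, q, r, s, t]"
    using Q unfolding Q_def by (elim conjE)
  have ne: "?e \<noteq> {p,q}" "?e \<noteq> {q,r}" "?e \<noteq> {r,s}" "?e \<noteq> {s,t}"
    using d unfolding tp by (auto simp: doubleton_eq_iff)
  then have n: "?e \<notin> {{p,q},{q,r},{r,s},{s,t}}"
    by (simp only: insert_iff empty_iff simp_thms not_False_eq_True)
  moreover have "{{p,q},{q,r},{r,s},{s,t}} \<subseteq> insert ?e (edges G)"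
    using Q unfolding Q_def by (simp only: insert_subset empty_subsetI simp_thms)
  ultimately have E: "{{p,q},{q,r},{r,s},{s,t}} \<subseteq> edges G"
    by (rule iffD1[OF subset_insert])
  let ?L = "[{p,q},{q,r},{r,s},{s,t}]"
  have "distinct (map ?c (?L @ [?e]))"
    using Q unfolding Q_def tp by (simp only: append.simps)
  then have "set (map ?c ?L) \<inter> {k} = {}"
    by (simp only: map_append distinct_append list.map(1,2)[of ?c] list.set fun_upd_same)
  moreover have "map ?c ?L = map c ?L"
    using n by (intro map_fun_upd) (simp only: list.set not_False_eq_True)
  ultimately have c: "k \<notin> c ` {{p,q},{q,r},{r,s},{s,t}}"
    by (simp only: list.set_map list.set) blast
  show ?thesis
  proof (cases "u = p")
    case True
    then have "v = t" using tp by (auto simp: doubleton_eq_iff)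
    then show ?thesis using True E c d by (intro exI[of _ q] exI[of _ r] exI[of _ s]) simp
  next
    case False
    then have "u = t" "v = p" using tp by (auto simp: doubleton_eq_iff)
    moreover have "distinct [t, s, r, q, p]"
      using d by auto
    ultimately show ?thesis
      using E c by (intro exI[of _ s] exI[of _ r] exI[of _ q]) (simp add: insert_commute)
  qed
qed

text \<open>Under an injective coloring a color sits on at most one edge, so avoiding the color of
  the new edge amounts to avoiding one edge \<open>f\<close>.\<close>

lemma rainbow_saturated_cycle5I:
  assumes G: "simple_graph G" and c: "inj_on c (edges G)"
    and free: "\<And>p q r s t. distinct [p, q, r, s, t] \<Longrightarrow>
        {{p,q},{q,r},{r,s},{s,t},{t,p}} \<subseteq> edges G \<Longrightarrow> False"
    and path: "\<And>u v f. u \<in> verts G \<Longrightarrow> v \<in> verts G \<Longrightarrow> u \<noteq> v \<Longrightarrow> {u, v} \<notin> edges G \<Longrightarrow>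
        \<exists>p q r. distinct [u, p, q, r, v] \<and>
          {{u,p},{p,q},{q,r},{r,v}} \<subseteq> edges G - {f}"
  shows "rainbow_saturated (cycle 5) G c"
  unfolding rainbow_saturated_def
proof (intro conjI ballI allI)
  show "rainbow_free (cycle 5) G c"
    unfolding rainbow_free_def has_rainbow_copy_cycle5_iff[OF G] by (intro notI, elim exE conjE) (rule free)
next
  fix e k
  assume e: "e \<in> nonedges G"
  then have "e \<subseteq> verts G" "card e = 2" and eE: "e \<notin> edges G"
    by (simp_all add: nonedges_def)
  then obtain u v where uv: "e = {u, v}" "u \<noteq> v" "u \<in> verts G" "v \<in> verts G"
    unfolding card_2_iff by blast
  \<comment> \<open>If no edge has color \<open>k\<close>, then \<open>f\<close> is an arbitrary
    set, and avoiding it does no harm.\<close>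
  define f where "f = the_inv_into (edges G) c k"
  have f: "g = f" if "g \<in> edges G" "c g = k" for g
    unfolding f_def that(2)[symmetric] by (rule the_inv_into_f_f[OF c that(1), symmetric])
  obtain p q r where d: "distinct [u, p, q, r, v]"
    and E: "{{u,p},{p,q},{q,r},{r,v}} \<subseteq> edges G - {f}"
    using path[OF uv(3,4,2) eE[unfolded uv(1)], of f] by (elim exE conjE) (rule that)
  let ?L = "[{u,p},{p,q},{q,r},{r,v}]"
  have L: "set ?L \<subseteq> edges G - {f}"
    using E by (simp only: list.set)
  then have "e \<notin> set ?L"
    using eE by blast
  then have "map (c(e := k)) ?L = map c ?L"
    by (rule map_fun_upd)
  then have eq: "map (c(e := k)) (?L @ [e]) = map c ?L @ [k]"
    by (simp only: map_append list.map fun_upd_same)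
  have "distinct ?L"
    using distinct_cycle5_edges[OF d] by (simp only: distinct.simps list.set insert_iff simp_thms de_Morgan_disj)
  moreover have "inj_on c (set ?L)"
    using L by (intro inj_on_subset[OF c]) blast
  moreover have "k \<notin> set (map c ?L)"
    using L f by (simp only: list.set_map) blast
  ultimately have "distinct (map (c(e := k)) (?L @ [e]))"
    unfolding eq distinct_append distinct_map by (simp only: distinct.simps list.set) blast
  then have "distinct (map (c(e := k)) [{u,p},{p,q},{q,r},{r,v},{v,u}])"
    unfolding uv(1) by (simp only: append.simps insert_commute[of v u])
  moreover have "{{u,p},{p,q},{q,r},{r,v},{v,u}} \<subseteq> edges (add_edge G e)"
    using E unfolding uv(1) add_edge_def snd_conv insert_commute[of v u] insert_subset by blast
  ultimately show "has_rainbow_copy (cycle 5) (add_edge G e) (c(e := k))"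
    unfolding has_rainbow_copy_cycle5_iff[OF simple_graph_add_edge[OF G e]]
    using d by (intro exI conjI)
qed

section \<open>Lower bound\<close>

locale avoiding_paths =
  fixes V :: "'a set" and E :: "'a set set" and c :: "'a set \<Rightarrow> nat"
  assumes finite_V: "finite V"
    and edge: "{a, b} \<in> E \<Longrightarrow> a \<in> V \<and> b \<in> V \<and> a \<noteq> b"
    and edge_pair: "e \<in> E \<Longrightarrow> \<exists>a b. e = {a, b} \<and> a \<noteq> b"
    and path: "u \<in> V \<Longrightarrow> v \<in> V \<Longrightarrow> u \<noteq> v \<Longrightarrow> {u, v} \<notin> E \<Longrightarrow>
      \<exists>p q r. distinct [u, p, q, r, v] \<and>
        {u,p} \<in> E \<and> {p,q} \<in> E \<and> {q,r} \<in> E \<and> {r,v} \<in> E \<and>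
        k \<noteq> c {u,p} \<and> k \<noteq> c {p,q} \<and> k \<noteq> c {q,r} \<and> k \<noteq> c {r,v}"
begin

definition nbs :: "'a \<Rightarrow> 'a set" where
  "nbs u = {w. {u, w} \<in> E}"

lemma nbs_iff: "w \<in> nbs u \<longleftrightarrow> {u, w} \<in> E"
  by (simp add: nbs_def)

lemma nbs_sym: "w \<in> nbs u \<longleftrightarrow> u \<in> nbs w"
  by (simp add: nbs_def insert_commute)

lemma nbs_subset: "nbs u \<subseteq> V"
  using edge by (auto simp: nbs_def)

lemma finite_nbs [simp]: "finite (nbs u)"
  using nbs_subset finite_V by (rule finite_subset)

lemma nbs_irrefl: "w \<in> nbs u \<Longrightarrow> w \<noteq> u"
  using edge by (auto simp: nbs_def)

lemma finite_E: "finite E"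
proof (rule finite_subset)
  show "E \<subseteq> Pow V"
    using edge edge_pair by blast
qed (simp add: finite_V)

text \<open>Double counting: each edge occurs as two ordered pairs, which together contribute
  \<open>m\<close>. With \<open>g\<close> constantly 1 this is the handshake lemma; with
  \<open>wt\<close> it splits each edge between its ends.\<close>

lemma sum_over_nbs:
  fixes g :: "'a \<Rightarrow> 'a \<Rightarrow> nat"
  assumes g: "\<And>a b. g a b + g b a = m"
  shows "(\<Sum>u\<in>V. \<Sum>w\<in>nbs u. g u w) = m * card E"
proof -
  define A where "A = Sigma V nbs"
  have A: "p \<in> A \<longleftrightarrow> {fst p, snd p} \<in> E" for p
    using edge[of "fst p" "snd p"] by (cases p) (auto simp: A_def nbs_def)
  have "finite A"
    using finite_V by (simp add: A_def)
  have "(\<Sum>u\<in>V. \<Sum>w\<in>nbs u. g u w) = (\<Sum>p\<in>A. g (fst p) (snd p))"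
    unfolding A_def using finite_V by (simp add: sum.Sigma case_prod_beta)
  also have "\<dots> = (\<Sum>e\<in>E. \<Sum>p\<in>{p\<in>A. {fst p, snd p} = e}. g (fst p) (snd p))"
    by (rule sum.group[symmetric]) (use \<open>finite A\<close> finite_E A in auto)
  also have "\<dots> = (\<Sum>e\<in>E. m)"
  proof (rule sum.cong)
    fix e assume e: "e \<in> E"
    then obtain a b where ab: "e = {a, b}" "a \<noteq> b"
      using edge_pair by blast
    have "{p\<in>A. {fst p, snd p} = e} = {(a, b), (b, a)}"
      using e unfolding A ab by (auto simp: doubleton_eq_iff insert_commute)
    then show "(\<Sum>p\<in>{p\<in>A. {fst p, snd p} = e}. g (fst p) (snd p)) = m"
      using ab(2) g by simp
  qed simp
  finally show ?thesis
    by (simp add: mult.commute)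
qed

text \<open>If \<open>p\<close> were the only neighbor of \<open>u\<close>, every path leaving
  \<open>u\<close> would start with \<open>{u, p}\<close>, so none could avoid the color of this
  edge.\<close>

lemma card_nbs_ge_2:
  assumes "card V \<ge> 3" "u \<in> V"
  shows "card (nbs u) \<ge> 2"
proof (rule ccontr)
  assume "\<not> card (nbs u) \<ge> 2"
  then have "card (nbs u) \<le> Suc 0"
    by simp
  then have eq: "p = q" if "p \<in> nbs u" "q \<in> nbs u" for p q
    using that by (simp add: card_le_Suc0_iff_eq)
  \<comment> \<open>Thanks to \<open>SOME\<close>, an isolated \<open>u\<close> is covered by the
    same argument; \<open>p\<close> is then arbitrary.\<close>
  define p where "p = (SOME p. p \<in> nbs u)"
  have p: "q = p" if "q \<in> nbs u" for q
    unfolding p_def using that by (metis eq someI)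
  have "card {u, p} < card V"
    using assms(1) card_insert_le_m1[of 2 "{p}" u] by simp
  then obtain w where w: "w \<in> V" "w \<noteq> u" "w \<noteq> p"
    using card_mono[of "{u, p}" V] by (metis finite.intros insertCI not_less subsetI)
  then have "{u, w} \<notin> E"
    using p[of w] by (auto simp: nbs_def)
  then obtain q where "{u, q} \<in> E" "c {u, q} \<noteq> c {u, p}"
    using path[OF assms(2) w(1), of "c {u, p}"] w(2) by metis
  then show False
    using p[of q] by (simp add: nbs_def)
qed

end

section \<open>Levels around a vertex of degree 2\<close>

locale avoiding_paths_deg2 = avoiding_paths +
  fixes v x y :: 'a
  assumes v: "v \<in> V" and nbs_v: "nbs v = {x, y}" and xy: "x \<noteq> y"
    and card_V: "card V \<ge> 3"
begin

text \<open>The distance from \<open>{v, x, y}\<close>, capped at 3. The neighbors of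
  \<open>v\<close> are \<open>x\<close> and \<open>y\<close> themselves, hence no clause for
  them.\<close>

definition lev :: "'a \<Rightarrow> nat" where
  "lev u =
    (if u \<in> {v, x, y} then 0
     else if u \<in> nbs x \<union> nbs y then 1
     else if \<exists>w \<in> nbs x \<union> nbs y. u \<in> nbs w then 2
     else 3)"

lemma lev_le_3: "lev u \<le> 3"
  by (simp add: lev_def)

lemma lev_0_iff: "lev u = 0 \<longleftrightarrow> u \<in> {v, x, y}"
  by (simp add: lev_def)

lemma v_nbs: "v \<in> nbs x" "v \<in> nbs y" "w \<in> nbs v \<longleftrightarrow> w = x \<or> w = y"
  using nbs_v by (auto simp: nbs_sym[of v])

lemma v_neq: "v \<noteq> x" "v \<noteq> y"
  using v_nbs nbs_irrefl by blast+

lemma lev_nbs_xy: "p \<in> {x, y} \<Longrightarrow> u \<in> nbs p \<Longrightarrow> lev u \<le> 1"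
  by (auto simp: lev_def)

lemma lev_nbs_low:
  assumes "lev b \<le> 1" "d \<in> nbs b"
  shows "lev d \<le> 2"
proof (cases "b = v")
  case True
  then show ?thesis
    using assms(2) v_nbs by (auto simp: lev_def)
next
  case False
  then have "b \<in> {x, y} \<or> b \<in> nbs x \<union> nbs y"
    using assms(1) by (auto simp: lev_def split: if_splits)
  then show ?thesis
    using assms(2) lev_nbs_xy[of b d] by (auto simp: lev_def)
qed

lemma lev_1_parent: "lev u = 1 \<Longrightarrow> \<exists>p\<in>{x, y}. p \<in> nbs u"
  by (auto simp: lev_def nbs_sym[of u] split: if_splits)

lemma lev_2_parent:
  assumes "lev u = 2"
  shows "\<exists>b. b \<in> nbs u \<and> lev b = 1"
proof -
  from assms obtain w where w: "w \<in> nbs x \<union> nbs y" "u \<in> nbs w"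
    and u: "u \<notin> {v, x, y}" "u \<notin> nbs x \<union> nbs y"
    by (auto simp: lev_def split: if_splits)
  then have "w \<notin> {v, x, y}"
    using v_nbs(3) by auto
  then show ?thesis
    using w by (intro exI[of _ w]) (auto simp: lev_def nbs_sym[of u])
qed

text \<open>The path is \<open>v a b d u\<close>. It must leave \<open>v\<close> through
  \<open>x\<close> or \<open>y\<close>, and from there the level grows by at most one per step,
  which bounds the levels of \<open>b\<close> and \<open>d\<close>.\<close>

lemma path_from_v:
  assumes "u \<in> V" "u \<notin> {v, x, y}"
  shows "\<exists>a b d. a \<in> {x, y} \<and> b \<in> nbs a \<and> d \<in> nbs b \<and> d \<in> nbs u \<and>
    c {a, b} \<noteq> k \<and> c {d, u} \<noteq> k \<and>
    a \<noteq> b \<and> b \<noteq> d \<and> b \<noteq> u \<and> b \<noteq> v \<and> lev b \<le> 1 \<and> lev d \<le> 2"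
proof -
  have "{v, u} \<notin> E" "v \<noteq> u"
    using assms(2) nbs_v nbs_iff by auto
  from path[OF v assms(1) this(2,1), of k]
  obtain a b d where d: "distinct [v, a, b, d, u]"
    and E: "{v,a} \<in> E" "{a,b} \<in> E" "{b,d} \<in> E" "{d,u} \<in> E"
    and c: "c {a,b} \<noteq> k" "c {d,u} \<noteq> k"
    by metis
  have n: "a \<in> nbs v" "b \<in> nbs a" "d \<in> nbs b" "d \<in> nbs u"
    using E by (simp_all add: nbs_iff insert_commute)
  have a: "a \<in> {x, y}"
    using n(1) nbs_v by simp
  then have b: "lev b \<le> 1"
    using lev_nbs_xy n(2) by blast
  then have "lev d \<le> 2"
    using lev_nbs_low n(3) by blast
  with d n a b c have "a \<in> {x, y} \<and> b \<in> nbs a \<and> d \<in> nbs b \<and> d \<in> nbs u \<and>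
    c {a, b} \<noteq> k \<and> c {d, u} \<noteq> k \<and>
    a \<noteq> b \<and> b \<noteq> d \<and> b \<noteq> u \<and> b \<noteq> v \<and> lev b \<le> 1 \<and> lev d \<le> 2"
    by auto
  then show ?thesis
    by (intro exI)
qed

text \<open>Everything is counted in half edges: an edge is worth 2 to its upper end.\<close>

definition wt :: "nat \<Rightarrow> nat \<Rightarrow> nat" where
  "wt i j = (if j < i then 2 else if j = i then 1 else 0)"

section \<open>Lower bounds for the load on each level\<close>

definition load :: "'a \<Rightarrow> nat" where
  "load u = (\<Sum>w\<in>nbs u. wt (lev u) (lev w))"

lemma sum_load: "(\<Sum>u\<in>V. load u) = 2 * card E"
  unfolding load_def by (rule sum_over_nbs) (simp add: wt_def)

lemma load_ge_sum: "S \<subseteq> nbs u \<Longrightarrow> (\<Sum>w\<in>S. wt (lev u) (lev w)) \<le> load u"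
  unfolding load_def by (rule sum_mono2) auto

lemma load_ge_pair:
  "p \<in> nbs u \<Longrightarrow> q \<in> nbs u \<Longrightarrow> p \<noteq> q \<Longrightarrow> wt (lev u) (lev p) + wt (lev u) (lev q) \<le> load u"
  using load_ge_sum[of "{p, q}" u] by simp

text \<open>Both edges at \<open>v\<close> stay on level 0 and give 1 to each end. Measured against
  3 per vertex, level 0 may thus fall short by 5, the additive constant of the final bound.\<close>

lemma load_level_0: "load v + load x + load y \<ge> 4"
proof -
  have "load v \<ge> 2"
    using load_ge_pair[of x v y] v_nbs xy by (simp add: wt_def lev_def)
  moreover have "load x \<ge> 1"
    using load_ge_sum[of "{v}" x] v_nbs by (simp add: wt_def lev_def)
  moreover have "load y \<ge> 1"
    using load_ge_sum[of "{v}" y] v_nbs by (simp add: wt_def lev_def)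
  ultimately show ?thesis
    by simp
qed

text \<open>The path from \<open>v\<close> enters \<open>u\<close> from a level of at most 2, worth
  2; a second neighbor is worth at least 1, as no level exceeds 3.\<close>

lemma load_level_3:
  assumes "u \<in> V" "lev u = 3"
  shows "load u \<ge> 3"
proof -
  have "u \<notin> {v, x, y}"
    using assms(2) lev_0_iff[of u] by simp
  from path_from_v[OF assms(1) this] obtain d where d: "d \<in> nbs u" "lev d \<le> 2"
    by blast
  have "card (nbs u) \<ge> 2"
    using card_nbs_ge_2 card_V assms(1) by blast
  then have "nbs u \<noteq> {d}"
    by auto
  then obtain e where e: "e \<in> nbs u" "e \<noteq> d"
    using d(1) by blast
  have "wt (lev u) (lev d) + wt (lev u) (lev e) \<le> load u"
    using d e load_ge_pair by simp
  then show ?thesis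
    using d(2) assms(2) lev_le_3[of e] by (simp add: wt_def split: if_splits)
qed

text \<open>A parent \<open>b\<close> on level 1 is worth 2. The path from \<open>v\<close> that
  avoids the color of \<open>{b, u}\<close> enters \<open>u\<close> through another vertex
  \<open>d\<close> of level at most 2, worth at least 1.\<close>

lemma load_level_2:
  assumes "u \<in> V" "lev u = 2"
  shows "load u \<ge> 3"
proof -
  obtain b where b: "b \<in> nbs u" "lev b = 1"
    using lev_2_parent assms(2) by blast
  have "u \<notin> {v, x, y}"
    using assms(2) lev_0_iff[of u] by simp
  from path_from_v[OF assms(1) this, of "c {b, u}"]
  obtain d where d: "d \<in> nbs u" "lev d \<le> 2" "c {d, u} \<noteq> c {b, u}"
    by blast
  have "wt (lev u) (lev b) + wt (lev u) (lev d) \<le> load u"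
    using d b load_ge_pair by blast
  then show ?thesis
    using d(2) b(2) assms(2) by (simp add: wt_def split: if_splits)
qed

text \<open>The only vertices above level 0 whose load can be less than 3, cf. \<open>load_level_1\<close>.\<close>

definition poor :: "'a \<Rightarrow> bool" where
  "poor u \<longleftrightarrow> u \<in> V \<and> lev u = 1 \<and> (\<exists>p\<in>{x, y}. \<forall>q\<in>nbs u. lev q \<le> 1 \<longrightarrow> q = p)"

text \<open>The parent is worth 2. A vertex that is not \<open>poor\<close> has a second neighbor of
  level at most 1, worth at least 1.\<close>

lemma load_level_1:
  assumes "u \<in> V" "lev u = 1"
  shows "load u \<ge> 2" "\<not> poor u \<Longrightarrow> load u \<ge> 3"
proof -
  obtain p where p: "p \<in> {x, y}" "p \<in> nbs u"
    using lev_1_parent assms(2) by blast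
  then have lp: "lev p = 0"
    using lev_0_iff[of p] by auto
  then show "load u \<ge> 2"
    using load_ge_sum[of "{p}" u] p assms(2) by (simp add: wt_def)
  assume "\<not> poor u"
  then obtain q where q: "q \<in> nbs u" "lev q \<le> 1" "q \<noteq> p"
    using assms p(1) unfolding poor_def by blast
  have "wt (lev u) (lev p) + wt (lev u) (lev q) \<le> load u"
    using load_ge_pair p q by blast
  then show "load u \<ge> 3"
    using lp q(2) assms(2) by (simp add: wt_def split: if_splits)
qed

section \<open>Compensation of poor vertices by level 2\<close>

lemma poor_donor:
  assumes "poor u"
  shows "\<exists>w. w \<in> nbs u \<and> lev w = 2 \<and> (\<exists>b. b \<in> nbs w \<and> b \<noteq> u \<and> lev b = 1)"
proof -
  from assms obtain p where u: "u \<in> V" "lev u = 1" and p: "p \<in> {x, y}"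
    and only: "\<And>q. q \<in> nbs u \<Longrightarrow> lev q \<le> 1 \<Longrightarrow> q = p"
    unfolding poor_def by blast
  have "u \<notin> {v, x, y}"
    using u(2) lev_0_iff[of u] by simp
  from path_from_v[OF u(1) this, of "c {p, u}"]
  obtain a b d where *: "d \<in> nbs b" "d \<in> nbs u" "c {d, u} \<noteq> c {p, u}" "b \<noteq> u" "b \<noteq> v"
    "lev b \<le> 1" "lev d \<le> 2"
    by blast
  \<comment> \<open>The path avoids the color of \<open>{p, u}\<close>, so it enters
    \<open>u\<close> through a vertex other than \<open>p\<close>; \<open>u\<close> being poor, that
    vertex lies on level 2.\<close>
  have "d \<noteq> p"
    using *(3) by blast
  then have d: "lev d = 2"
    using only[OF *(2)] *(7) by linarith
  \<comment> \<open>Neighbors of \<open>x\<close> and \<open>y\<close> have level at most 1, whereas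
    \<open>d\<close> has level 2.\<close>
  have "b \<notin> {x, y}"
    using lev_nbs_xy[of b d] *(1) d by auto
  then have "lev b = 1"
    using *(5,6) lev_0_iff[of b] by auto
  then show ?thesis
    using * d nbs_sym by blast
qed

text \<open>Chooses the level 2 neighbor that hands one unit to a poor vertex. The vertex
  \<open>b\<close> ensures that a donor has at least two neighbors on level 1.\<close>

definition donor :: "'a \<Rightarrow> 'a" where
  "donor u = (SOME w. w \<in> nbs u \<and> lev w = 2 \<and> (\<exists>b. b \<in> nbs w \<and> b \<noteq> u \<and> lev b = 1))"

lemma donor:
  assumes "poor u"
  shows "donor u \<in> nbs u" "lev (donor u) = 2" "\<exists>b. b \<in> nbs (donor u) \<and> b \<noteq> u \<and> lev b = 1"
  using someI_ex[OF poor_donor[OF assms]] unfolding donor_def by blast+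

text \<open>\<open>D\<close> contains \<open>B\<close> and contributes \<open>2 * card D\<close>,
  which is enough when \<open>D\<close> has at least three elements. If \<open>B\<close> is a
  singleton, the donor has a second level 1 neighbor and load at least 4. If \<open>B = D\<close>
  has two elements, one more unit has to be found, on level 2.\<close>

lemma load_donor:
  assumes w: "w \<in> V" "lev w = 2"
  shows "load w \<ge> 3 + card {u. poor u \<and> donor u = w}"
proof -
  define B where "B = {u. poor u \<and> donor u = w}"
  define D where "D = {u \<in> nbs w. lev u = 1}"
  have BD: "B \<subseteq> D"
    unfolding B_def D_def using donor nbs_sym by (auto simp: poor_def)
  have fin: "finite D"
    by (simp add: D_def)
  have DN: "D \<subseteq> nbs w"
    by (auto simp: D_def)
  have "(\<Sum>u\<in>D. wt (lev w) (lev u)) = (\<Sum>u\<in>D. 2)"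
    by (rule sum.cong) (auto simp: D_def w wt_def)
  then have sum_D: "(\<Sum>u\<in>D. wt (lev w) (lev u)) = 2 * card D"
    by simp
  then have load_D: "2 * card D \<le> load w"
    using load_ge_sum[OF DN] by simp
  have cBD: "card B \<le> card D"
    using BD fin by (rule card_mono[rotated])
  consider "B = {}" | "card B = 1" | "card D \<ge> 3" | "card D = 2" "card B = 2"
  proof -
    have "card B = 0 \<Longrightarrow> B = {}"
      using BD fin finite_subset by fastforce
    then show thesis
      using that cBD by linarith
  qed
  then have "load w \<ge> 3 + card B"
  proof cases
    case 1
    then show ?thesis
      using load_level_2 w by simp
  next
    case 2
    then obtain u where "u \<in> B"
      by (metis card_1_singletonE singletonI)
    then have u: "poor u" "donor u = w"
      by (simp_all add: B_def)
    obtain b where b: "b \<in> D" "b \<noteq> u"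
      using donor(3)[OF u(1)] unfolding u(2) D_def by blast
    have "u \<in> D"
      using BD \<open>u \<in> B\<close> by blast
    then have "card {u, b} \<le> card D"
      using b fin by (intro card_mono) auto
    then show ?thesis
      using load_D 2 b(2) by simp
  next
    case 3
    then show ?thesis
      using load_D cBD by simp
  next
    case 4
    then have "B = D"
      using card_subset_eq[OF fin BD] by simp
    have "w \<notin> {v, x, y}"
      using w(2) lev_0_iff[of w] by simp
    \<comment> \<open>If all level 1 neighbors of \<open>w\<close> were poor and \<open>w\<close> had no neighbor on its own level, every
      path of length 4 from \<open>v\<close> to \<open>w\<close> would pass through the edge \<open>x y\<close>.\<close>
    from path_from_v[OF w(1) this, of "c {x, y}"]
    obtain a b d where *: "a \<in> {x, y}" "a \<noteq> b" "d \<in> nbs b" "d \<in> nbs w" "c {a, b} \<noteq> c {x, y}"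
      "lev b \<le> 1" "lev d \<le> 2"
      by blast
    have "d \<notin> B"
    proof
      assume "d \<in> B"
      then obtain p where p: "p \<in> {x, y}" "\<And>q. q \<in> nbs d \<Longrightarrow> lev q \<le> 1 \<Longrightarrow> q = p"
        unfolding B_def poor_def by blast
      then have "b = p"
        using * nbs_sym by blast
      then have "{a, b} = {x, y}"
        using *(1,2) p(1) by auto
      then show False
        using *(5) by simp
    qed
    then have "d \<notin> D"
      using \<open>B = D\<close> by simp
    have "d \<notin> {v, x, y}"
      using \<open>w \<notin> {v, x, y}\<close> *(4) lev_nbs_xy[of d w] w(2) v_nbs(3)[of w] nbs_sym[of d w] by auto
    then have "lev d = 2"
      using \<open>d \<notin> D\<close> *(4,7) lev_0_iff[of d] by (auto simp: D_def)
    have "wt (lev w) (lev d) = 1"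
      using \<open>lev d = 2\<close> w(2) by (simp add: wt_def)
    then have "(\<Sum>u\<in>insert d D. wt (lev w) (lev u)) = 5"
      using \<open>d \<notin> D\<close> fin 4 sum_D by simp
    then have "5 \<le> load w"
      using load_ge_sum[of "insert d D" w] *(4) DN by simp
    then show ?thesis
      using 4 by simp
  qed
  then show ?thesis
    by (simp add: B_def)
qed

text \<open>Discharging: after each donor has passed one unit to every poor vertex it serves, every
  vertex above level 0 holds at least 3 units.\<close>

lemma load_bound:
  assumes "u \<in> V - {v, x, y}"
  shows "3 + card {z. poor z \<and> donor z = u} \<le> load u + (if poor u then 1 else 0)"
proof (cases "lev u = 2")
  case True
  then show ?thesis
    using load_donor[of u] assms by simp
next
  case False
  then have none: "{z. poor z \<and> donor z = u} = {}"
    using donor(2) by auto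
  have "lev u \<noteq> 0"
    using assms lev_0_iff by blast
  then have "lev u = 1 \<or> lev u = 3"
    using False lev_le_3[of u] by linarith
  then show ?thesis
    unfolding none using load_level_1[of u] load_level_3[of u] assms by (auto simp: poor_def)
qed

text \<open>Units handed over and units received both total the number of poor vertices, so the
  vertices above level 0 carry at least 3 units on average; level 0 contributes at least 4 instead
  of 9.\<close>

lemma card_edges_ge: "3 * card V \<le> 2 * card E + 5"
proof -
  define W where "W = V - {v, x, y}"
  have fin: "finite W"
    using finite_V by (simp add: W_def)
  have xyV: "x \<in> V" "y \<in> V"
    using nbs_subset[of v] nbs_v by auto
  have split: "(\<Sum>u\<in>V. g u) = g v + g x + g y + (\<Sum>u\<in>W. g u)" for g :: "'a \<Rightarrow> nat"
  proof -
    have "V = insert v (insert x (insert y W))"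
      using v xyV by (auto simp: W_def)
    then have "(\<Sum>u\<in>V. g u) = (\<Sum>u\<in>insert v (insert x (insert y W)). g u)"
      by simp
    also have "\<dots> = g v + g x + g y + (\<Sum>u\<in>W. g u)"
      using fin v_neq xy by (simp add: W_def)
    finally show ?thesis .
  qed
  have P: "{u. poor u} \<subseteq> W"
  proof
    fix u assume "u \<in> {u. poor u}"
    then have "u \<in> V" "lev u \<noteq> 0"
      by (simp_all add: poor_def)
    then show "u \<in> W"
      unfolding W_def lev_0_iff by blast
  qed
  then have finP: "finite {u. poor u}"
    using fin finite_subset by blast
  have donor_W: "donor ` {u. poor u} \<subseteq> W"
  proof
    fix w assume "w \<in> donor ` {u. poor u}"
    then obtain u where "poor u" "w = donor u"
      by blast
    then have "w \<in> V" "lev w \<noteq> 0"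
      using donor(1,2)[of u] nbs_subset[of u] by auto
    then show "w \<in> W"
      unfolding W_def lev_0_iff by blast
  qed
  \<comment> \<open>The fibers of \<open>donor\<close> partition the poor vertices.\<close>
  have "(\<Sum>u\<in>W. card {z. poor z \<and> donor z = u}) = card {u. poor u}"
    using sum.group[OF finP fin donor_W, of "\<lambda>_. 1::nat"] by simp
  moreover have "(\<Sum>u\<in>W. if poor u then 1 else 0 :: nat) = card {u. poor u}"
    using P fin by (simp add: sum.If_cases Int_absorb1)
  moreover have "(\<Sum>u\<in>W. 3 + card {z. poor z \<and> donor z = u})
      \<le> (\<Sum>u\<in>W. load u + (if poor u then 1 else 0))"
    by (rule sum_mono) (use load_bound W_def in blast)
  ultimately have "3 * card W \<le> (\<Sum>u\<in>W. load u)"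
    by (simp add: sum.distrib)
  moreover have "card V = 3 + card W"
    using split[of "\<lambda>_. 1"] by simp
  ultimately show ?thesis
    using sum_load load_level_0 split[of load] by linarith
qed

end

text \<open>Degrees are at least 2. If none equals 2, all are at least 3 and the handshake lemma
  even gives \<open>3 * card V \<le> 2 * card E\<close>.\<close>

lemma (in avoiding_paths) card_edges_lower_bound:
  assumes "card V \<ge> 3"
  shows "3 * card V \<le> 2 * card E + 5"
proof (cases "\<exists>v\<in>V. card (nbs v) = 2")
  case True
  then obtain v x y where "v \<in> V" "nbs v = {x, y}" "x \<noteq> y"
    by (auto simp: card_2_iff)
  then interpret avoiding_paths_deg2 V E c v x y
    using assms by unfold_locales
  show ?thesis
    by (rule card_edges_ge)
next
  case False
  then have "3 \<le> card (nbs u)" if "u \<in> V" for u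
    using card_nbs_ge_2[OF assms that] that by (metis Suc_leI eval_nat_numeral(3) le_neq_implies_less)
  then have "(\<Sum>u\<in>V. 3) \<le> (\<Sum>u\<in>V. card (nbs u))"
    by (rule sum_mono)
  then show ?thesis
    using sum_over_nbs[of "\<lambda>_ _. 1" 2] by simp
qed

section \<open>Upper bound\<close>

text \<open>The \<open>K\<^sub>4\<close> is on 0, 1, 2, 3; the triangles are 1 4 5, 2 6 7 and 3 8 9; the book has spine
  0 10 and pages 11, 12, ...\<close>

definition arcs :: "nat \<Rightarrow> (nat \<times> nat) set" where
  "arcs n =
    {(0,1),(0,2),(0,3),(1,2),(1,3),(2,3),
     (1,4),(1,5),(4,5), (2,6),(2,7),(6,7), (3,8),(3,9),(8,9), (0,10)}
    \<union> {0,10} \<times> {11..<n}"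

definition extremal_graph :: "nat \<Rightarrow> nat graph" where
  "extremal_graph n = ({..<n}, (\<lambda>(a, b). {a, b}) ` arcs n)"

abbreviation adj :: "nat \<Rightarrow> nat \<Rightarrow> nat \<Rightarrow> bool" where
  "adj n a b \<equiv> {a, b} \<in> edges (extremal_graph n)"

lemma adj_iff: "adj n a b \<longleftrightarrow> (a, b) \<in> arcs n \<or> (b, a) \<in> arcs n"
proof
  assume "adj n a b"
  then obtain p q where "(p, q) \<in> arcs n" "{a, b} = {p, q}"
    unfolding extremal_graph_def by auto
  then show "(a, b) \<in> arcs n \<or> (b, a) \<in> arcs n"
    by (auto simp: doubleton_eq_iff)
next
  assume "(a, b) \<in> arcs n \<or> (b, a) \<in> arcs n"
  then show "adj n a b"
    unfolding extremal_graph_def by (auto simp: insert_commute intro: rev_image_eqI)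
qed

lemma verts_extremal_graph: "verts (extremal_graph n) = {..<n}"
  by (simp add: extremal_graph_def)

text \<open>Sixteen fixed edges and two for each of the \<open>n - 11\<close> pages add up to
  \<open>2 * n - 6\<close>.\<close>

lemma card_edges_extremal_graph:
  assumes "n \<ge> 11"
  shows "card (edges (extremal_graph n)) \<le> 2 * n - 6"
proof -
  have "card (arcs n) \<le> 16 + 2 * (n - 11)"
    unfolding arcs_def by (rule order_trans[OF card_Un_le]) (simp add: card_cartesian_product)
  moreover have "card (edges (extremal_graph n)) \<le> card (arcs n)"
    unfolding extremal_graph_def snd_conv by (rule card_image_le) (simp add: arcs_def)
  ultimately show ?thesis
    using assms by simp
qed

lemma simple_extremal_graph:
  assumes "n \<ge> 11"
  shows "simple_graph (extremal_graph n)"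
proof -
  have "a \<noteq> b \<and> a < n \<and> b < n" if "(a, b) \<in> arcs n" for a b
    using that assms by (auto simp: arcs_def)
  then show ?thesis
    unfolding simple_graph_def extremal_graph_def by fastforce
qed

text \<open>Every vertex \<open>u\<close> outside the \<open>K\<^sub>4\<close> lies in a triangle \<open>u\<close>, \<open>mate u\<close>, \<open>base u\<close> with \<open>base u\<close>
  in the \<open>K\<^sub>4\<close>. The mate of 10 may be any page.\<close>

definition base :: "nat \<Rightarrow> nat" where
  "base u = (if u < 10 then u div 2 - 1 else 0)"

definition mate :: "nat \<Rightarrow> nat" where
  "mate u = (if u < 10 then if even u then u + 1 else u - 1 else if u = 10 then 11 else 10)"

lemma between_4_10: "4 \<le> (u::nat) \<Longrightarrow> u < 10 \<Longrightarrow> u \<in> {4,5,6,7,8,9}"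
  by auto

lemma hanging_triangle:
  assumes "4 \<le> u" "u < n" "n \<ge> 15"
  shows "adj n u (base u)" "adj n u (mate u)" "adj n (mate u) (base u)"
    "base u < 4" "4 \<le> mate u" "mate u \<noteq> u" "base (mate u) = base u"
proof -
  consider "u \<in> {4,5,6,7,8,9}" | "u = 10" | "u \<ge> 11"
    using assms(1) by fastforce
  then have "adj n u (base u) \<and> adj n u (mate u) \<and> adj n (mate u) (base u) \<and>
      base u < 4 \<and> 4 \<le> mate u \<and> mate u \<noteq> u \<and> base (mate u) = base u"
  proof cases
    case 1
    then show ?thesis
      by (elim insertE emptyE; simp add: adj_iff arcs_def base_def mate_def)
  qed (use assms in \<open>auto simp: adj_iff arcs_def base_def mate_def\<close>)
  then show "adj n u (base u)" "adj n u (mate u)" "adj n (mate u) (base u)"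
    "base u < 4" "4 \<le> mate u" "mate u \<noteq> u" "base (mate u) = base u"
    by simp_all
qed

lemma adj_K4: "a < 4 \<Longrightarrow> b < 4 \<Longrightarrow> a \<noteq> b \<Longrightarrow> adj n a b"
proof -
  assume "a < 4" "b < 4" "a \<noteq> b"
  then have "a \<in> {0,1,2,3}" "b \<in> {0,1,2,3}" "a \<noteq> b"
    by auto
  then show ?thesis
    by (elim insertE emptyE; simp add: adj_iff arcs_def)
qed

section \<open>Absence of pentagons\<close>

lemma adj_hanging:
  assumes "adj n u w" "4 \<le> u"
  shows "u < 10 \<and> (w = base u \<or> w = mate u) \<or> u = 10 \<and> (w = 0 \<or> w \<ge> 11) \<or> u \<ge> 11 \<and> (w = 0 \<or> w = 10)"
  using assms by (auto simp: adj_iff arcs_def base_def mate_def)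

text \<open>Each hanging triangle or book meets the \<open>K\<^sub>4\<close> in a single vertex, so
  a cycle through a vertex outside the \<open>K\<^sub>4\<close> stays inside that triangle or book,
  and these have cycles of length 3 and 4 only.\<close>

lemma pentagon_in_K4:
  assumes d: "distinct [p, q, r, s, t]"
    and adj: "adj n p q" "adj n q r" "adj n r s" "adj n s t" "adj n t p"
  shows "p < 4"
proof (rule ccontr)
  assume "\<not> p < 4"
  then have p: "4 \<le> p"
    by simp
  have adj': "adj n p t" "adj n t s" "adj n s r"
    using adj by (simp_all add: insert_commute)
  show False
  proof (cases "p < 10")
    case True
    then have "p \<in> {4,5,6,7,8,9}"
      using p between_4_10 by blast
    then have m: "4 \<le> mate p" "mate p < 10" "mate (mate p) = p" "base (mate p) = base p"
      by (auto simp: mate_def base_def)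
    have "q = base p \<or> q = mate p" "t = base p \<or> t = mate p"
      using adj_hanging[OF adj(1) p] adj_hanging[OF adj'(1) p] True by auto
    \<comment> \<open>Past the mate, the cycle could continue only to \<open>p\<close> or
      \<open>base p\<close>, both already used.\<close>
    then consider "q = mate p" "t = base p" | "t = mate p" "q = base p"
      using d by auto
    then show False
    proof cases
      case 1
      then show False
        using adj_hanging[OF adj(2)] m d by auto
    next
      case 2
      then show False
        using adj_hanging[OF adj'(2)] m d by auto
    qed
  next
    case False
    have pages: "b = 0 \<or> b = 10" if "adj n a b" "a \<ge> 11" for a b
      using adj_hanging[OF that(1)] that(2) by auto
    have spine: "b = 0 \<or> b \<ge> 11" if "adj n 10 b" for b
      using adj_hanging[OF that] by auto
    show False
    proof (cases "p = 10")
      case True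
      then show False
        using spine[of q] spine[of t] pages[of q r] pages[of t s] adj adj' d by auto
    next
      case False
      \<comment> \<open>Beyond \<open>10\<close> the cycle must pass to another page, whose next
        vertex would again be \<open>0\<close> or \<open>10\<close>.\<close>
      then have "q = 0 \<and> t = 10 \<or> q = 10 \<and> t = 0"
        using pages[of p q] pages[of p t] adj adj' d \<open>\<not> p < 10\<close> by auto
      then show False
        using spine[of r] spine[of s] pages[of r s] pages[of s r] adj adj' d by auto
    qed
  qed
qed

lemma no_pentagon:
  assumes d: "distinct [p, q, r, s, t]"
    and adj: "adj n p q" "adj n q r" "adj n r s" "adj n s t" "adj n t p"
  shows False
proof -
  have "p < 4" "q < 4" "r < 4" "s < 4" "t < 4"
    using pentagon_in_K4[of p q r s t] pentagon_in_K4[of q r s t p]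
      pentagon_in_K4[of r s t p q] pentagon_in_K4[of s t p q r]
      pentagon_in_K4[of t p q r s] d adj by auto
  then have "set [p, q, r, s, t] \<subseteq> {..<4}"
    by simp
  then have "card (set [p, q, r, s, t]) \<le> 4"
    using card_mono[of "{..<4::nat}"] by fastforce
  then show False
    using distinct_card[OF d] by simp
qed

section \<open>Paths of length 4 that miss a given edge\<close>

definition avoiding_path :: "'a set set \<Rightarrow> 'a set \<Rightarrow> 'a \<Rightarrow> 'a \<Rightarrow> 'a \<Rightarrow> 'a \<Rightarrow> 'a \<Rightarrow> bool" where
  "avoiding_path E f a b c d e \<longleftrightarrow> distinct [a, b, c, d, e] \<and>
     {a, b} \<in> E \<and> {b, c} \<in> E \<and> {c, d} \<in> E \<and> {d, e} \<in> E \<and>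
     f \<noteq> {a, b} \<and> f \<noteq> {b, c} \<and> f \<noteq> {c, d} \<and> f \<noteq> {d, e}"

lemma avoiding_path_rev: "avoiding_path E f a b c d e \<Longrightarrow> avoiding_path E f e d c b a"
  unfolding avoiding_path_def
  by (auto simp: insert_commute[of e d] insert_commute[of d c] insert_commute[of c b] insert_commute[of b a])

text \<open>The standard route is \<open>u u' x p z\<close>. A forbidden edge on its triangle half
  is bypassed by \<open>u x p q z\<close>, one on its \<open>K\<^sub>4\<close> half by
  \<open>u u' x q z\<close>.\<close>

lemma avoiding_path_triangle_K4:
  assumes d: "distinct [u, u', x, p, q, z]"
    and E: "{u, x} \<in> E" "{u, u'} \<in> E" "{u', x} \<in> E"
      "{x, p} \<in> E" "{x, q} \<in> E" "{p, q} \<in> E" "{p, z} \<in> E" "{q, z} \<in> E"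
  shows "\<exists>a b c. avoiding_path E f u a b c z"
proof -
  consider "f \<in> {{u, u'}, {u', x}}" | "f \<in> {{x, p}, {p, z}}"
    | "f \<notin> {{u, u'}, {u', x}}" "f \<notin> {{x, p}, {p, z}}"
    by metis
  then show ?thesis
  proof cases
    case 1
    then have "avoiding_path E f u x p q z"
      unfolding avoiding_path_def using d distinct_rev[THEN iffD2, OF d] E
      by (elim insertE emptyE; simp add: doubleton_eq_iff)
    then show ?thesis by blast
  next
    case 2
    then have "avoiding_path E f u u' x q z"
      unfolding avoiding_path_def using d distinct_rev[THEN iffD2, OF d] E
      by (elim insertE emptyE; simp add: doubleton_eq_iff)
    then show ?thesis by blast
  next
    case 3
    then have "avoiding_path E f u u' x p z"
      unfolding avoiding_path_def using d distinct_rev[THEN iffD2, OF d] E by simp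
    then show ?thesis by blast
  qed
qed

text \<open>The standard route \<open>u u' x y w\<close> is replaced by \<open>u x p y w\<close> if
  \<open>f\<close> is one of its first three edges, and by \<open>u x y w' w\<close> if
  \<open>f\<close> is the last.\<close>

lemma avoiding_path_two_triangles:
  assumes d: "distinct [u, u', w, w', x, y, p]"
    and E: "{u, x} \<in> E" "{u, u'} \<in> E" "{u', x} \<in> E"
      "{y, w} \<in> E" "{w', w} \<in> E" "{y, w'} \<in> E"
      "{x, y} \<in> E" "{x, p} \<in> E" "{p, y} \<in> E"
  shows "\<exists>a b c. avoiding_path E f u a b c w"
proof -
  consider "f \<in> {{u, u'}, {u', x}, {x, y}}" | "f = {y, w}"
    | "f \<notin> {{u, u'}, {u', x}, {x, y}}" "f \<noteq> {y, w}"
    by metis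
  then show ?thesis
  proof cases
    case 1
    then have "avoiding_path E f u x p y w"
      unfolding avoiding_path_def using d distinct_rev[THEN iffD2, OF d] E
      by (elim insertE emptyE; simp add: doubleton_eq_iff)
    then show ?thesis by blast
  next
    case 2
    then have "avoiding_path E f u x y w' w"
      unfolding avoiding_path_def using d distinct_rev[THEN iffD2, OF d] E
      by (simp add: doubleton_eq_iff)
    then show ?thesis by blast
  next
    case 3
    then have "avoiding_path E f u u' x y w"
      unfolding avoiding_path_def using d distinct_rev[THEN iffD2, OF d] E by simp
    then show ?thesis by blast
  qed
qed

text \<open>The routes \<open>u a p b w\<close> and \<open>u b q a w\<close> share no edge, so at
  least one of them misses \<open>f\<close>.\<close>

lemma avoiding_path_book:
  assumes d: "distinct [a, b, u, w, p, q]"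
    and E: "{u, a} \<in> E" "{a, p} \<in> E" "{p, b} \<in> E" "{b, w} \<in> E"
      "{u, b} \<in> E" "{b, q} \<in> E" "{q, a} \<in> E" "{a, w} \<in> E"
  shows "\<exists>i j k. avoiding_path E f u i j k w"
proof (cases "f \<in> {{u, a}, {a, p}, {p, b}, {b, w}}")
  case True
  then have "avoiding_path E f u b q a w"
    unfolding avoiding_path_def using d distinct_rev[THEN iffD2, OF d] E
      by (elim insertE emptyE; simp add: doubleton_eq_iff)
  then show ?thesis by blast
next
  case False
  then have "avoiding_path E f u a p b w"
    unfolding avoiding_path_def using d distinct_rev[THEN iffD2, OF d] E by simp
  then show ?thesis by blast
qed

lemma K4_rest:
  assumes "x < 4" "z < (4::nat)"
  obtains p q where "p < 4" "q < 4" "p \<noteq> x" "q \<noteq> x" "p \<noteq> q" "p \<noteq> z" "q \<noteq> z"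
proof -
  have "x \<in> {0,1,2,3}" "z \<in> {0,1,2,3}"
    using assms by auto
  then have "\<exists>p\<in>{0,1,2,3}. \<exists>q\<in>{0,1,2,3}. p \<noteq> x \<and> q \<noteq> x \<and> p \<noteq> q \<and> p \<noteq> z \<and> q \<noteq> z"
    by (elim insertE emptyE; simp)
  then obtain p q where pq: "p \<in> {0,1,2,3}" "q \<in> {0,1,2,3}" "p \<noteq> x \<and> q \<noteq> x \<and> p \<noteq> q \<and> p \<noteq> z \<and> q \<noteq> z"
    by (elim bexE)
  have "p < 4" "q < 4"
    using pq(1,2) by (elim insertE emptyE; simp)+
  then show thesis
    using that pq(3) by (elim conjE)
qed

text \<open>The threshold \<open>m\<close> separates two groups of vertices, so that only
  comparisons within each group are left.\<close>

lemma distinct_across: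
  fixes xs ys :: "nat list"
  assumes "distinct xs" "distinct ys" "set xs \<subseteq> {m..}" "set ys \<subseteq> {..<m}"
  shows "distinct (xs @ ys)"
proof -
  have "set xs \<inter> set ys = {}"
    using assms(3,4) by fastforce
  then show ?thesis
    using assms(1,2) by simp
qed

lemma avoiding_path_hanging_K4:
  assumes u: "4 \<le> u" "u < n" "n \<ge> 15" and z: "z < 4" "\<not> adj n u z"
  shows "\<exists>a b c. avoiding_path (edges (extremal_graph n)) f u a b c z"
proof -
  define x where "x = base u"
  define u' where "u' = mate u"
  note h = hanging_triangle[OF u, folded x_def u'_def]
  have "x \<noteq> z"
    using h(1) z(2) by metis
  obtain p q where pq: "p < 4" "q < 4" "p \<noteq> x" "q \<noteq> x" "p \<noteq> q" "p \<noteq> z" "q \<noteq> z"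
    using K4_rest[OF h(4) z(1)] .
  have "distinct ([u, u'] @ [x, p, q, z])"
  proof (rule distinct_across[of _ _ 4])
    show "distinct [x, p, q, z]"
      using \<open>x \<noteq> z\<close> pq(3-7) by auto
  qed (use h u(1) pq z(1) in simp_all)
  then have "distinct [u, u', x, p, q, z]"
    by (simp only: append.simps)
  then show ?thesis
    by (rule avoiding_path_triangle_K4) (use h(1-4) pq z(1) adj_K4 in \<open>metis\<close>)+
qed

lemma avoiding_path_hanging_hanging:
  assumes u: "4 \<le> u" "u < n" "n \<ge> 15" and w: "4 \<le> w" "w < n"
    and ne: "base u \<noteq> base w"
  shows "\<exists>a b c. avoiding_path (edges (extremal_graph n)) f u a b c w"
proof -
  define x y where "x = base u" and "y = base w"
  define u' w' where "u' = mate u" and "w' = mate w"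
  note hu = hanging_triangle[OF u, folded x_def u'_def]
  note hw = hanging_triangle[OF w u(3), folded y_def w'_def]
  have xy: "x \<noteq> y"
    using ne by (simp add: x_def y_def)
  obtain p where p: "p < 4" "p \<noteq> x" "p \<noteq> y"
    by (rule K4_rest[OF hu(4) hw(4)]) (rule that)
  \<comment> \<open>Mates share their base, so vertices over different bases are distinct.\<close>
  have "u \<noteq> w" "u' \<noteq> w" "u \<noteq> w'" "u' \<noteq> w'"
    using hu(7) hw(7) xy x_def y_def by metis+
  then have "distinct [u, u', w, w']"
    using hu(6) hw(6) by auto
  moreover have "distinct [x, y, p]"
    using xy p(2,3) by auto
  ultimately have "distinct ([u, u', w, w'] @ [x, y, p])"
    by (rule distinct_across[of _ _ 4]) (use u(1) w(1) hu(4,5) hw(4,5) p(1) in simp_all)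
  then have "distinct [u, u', w, w', x, y, p]"
    by (simp only: append.simps)
  then show ?thesis
    by (rule avoiding_path_two_triangles)
      (use hu(1-4) hw(1-4) p xy adj_K4 insert_commute in \<open>metis\<close>)+
qed

lemma avoiding_path_pages:
  assumes n: "n \<ge> 15" and u: "11 \<le> u" "u < n" and w: "11 \<le> w" "w < n" and "u \<noteq> w"
  shows "\<exists>a b c. avoiding_path (edges (extremal_graph n)) f u a b c w"
proof -
  have page: "adj n v 0" "adj n v 10" "adj n 0 v" "adj n 10 v" if "11 \<le> v" "v < n" for v
    using that by (auto simp: adj_iff arcs_def)
  \<comment> \<open>The pages 11 to 14 exist because \<open>n \<ge> 15\<close>; at least two of them
    differ from \<open>u\<close> and \<open>w\<close> and serve as middle vertices of the two
    routes.\<close>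
  have "2 \<le> card ({11,12,13,14} - {u, w})"
    using diff_card_le_card_Diff[of "{u, w}" "{11,12,13,14}"] \<open>u \<noteq> w\<close> by simp
  then obtain S where "S \<subseteq> {11,12,13,14} - {u, w}" "card S = 2"
    by (rule obtain_subset_with_card_n)
  then obtain p q where pq: "p \<in> {11,12,13,14} - {u, w}" "q \<in> {11,12,13,14} - {u, w}" "p \<noteq> q"
    unfolding card_2_iff by blast
  have p: "11 \<le> p" "p < n" and q: "11 \<le> q" "q < n"
    using pq(1,2) n by auto
  have "distinct [u, w, p, q]"
    using pq \<open>u \<noteq> w\<close> by auto
  then have "distinct ([u, w, p, q] @ [0, 10])"
    by (rule distinct_across[of _ _ 11]) (use u w p q in simp_all)
  \<comment> \<open>Rotation brings the spine to the front, the order that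
    \<open>avoiding_path_book\<close> expects.\<close>
  then have "distinct (rotate 4 [u, w, p, q, 0, 10])"
    by (simp only: distinct_rotate append.simps)
  then have "distinct [0, 10, u, w, p, q]"
    by (simp add: numeral_eq_Suc)
  then show ?thesis
    by (rule avoiding_path_book) (rule page, fact, fact)+
qed

text \<open>Exactly two vertices hang over each of the bases 1, 2 and 3; the last hypothesis
  excludes base 0.\<close>

lemma mate_unique:
  assumes "4 \<le> u" "4 \<le> w" "u \<noteq> w" "base u = base w" "u < 10 \<or> w < 10"
  shows "w = mate u"
proof -
  have "base a \<noteq> 0" if "4 \<le> a" "a < 10" for a
    using between_4_10[OF that] by (elim insertE emptyE; simp add: base_def)
  moreover have "base a = 0" if "\<not> a < 10" for a
    using that by (simp add: base_def)
  ultimately have "u < 10" "w < 10"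
    using assms by metis+
  then have "u \<in> {4,5,6,7,8,9}" "w \<in> {4,5,6,7,8,9}"
    using between_4_10 assms(1,2) by blast+
  then show ?thesis
    using assms(3,4) by (elim insertE emptyE; simp add: base_def mate_def)
qed

text \<open>Distinct hanging vertices with the same base are adjacent unless both are pages: mates
  are adjacent, and \<open>10\<close> is adjacent to every page. All other nonadjacent pairs are
  joined through the \<open>K\<^sub>4\<close>.\<close>

lemma avoiding_path_nonadjacent:
  assumes n: "n \<ge> 15" and uw: "u < n" "w < n" "u \<noteq> w" "\<not> adj n u w"
  shows "\<exists>p q r. avoiding_path (edges (extremal_graph n)) f u p q r w"
proof -
  consider "u < 4" "w < 4" | "u \<ge> 4" "w < 4" | "u < 4" "w \<ge> 4"
    | "u \<ge> 4" "w \<ge> 4" "base u \<noteq> base w" | "u \<ge> 4" "w \<ge> 4" "base u = base w"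
    by (metis not_less)
  then show ?thesis
  proof cases
    case 1
    then show ?thesis
      using adj_K4 uw by blast
  next
    case 2
    then show ?thesis
      using avoiding_path_hanging_K4 n uw by blast
  next
    case 3
    have "\<not> adj n w u"
      using uw(4) by (simp add: insert_commute)
    then have "\<exists>p q r. avoiding_path (edges (extremal_graph n)) f w p q r u"
      using avoiding_path_hanging_K4 n uw 3 by blast
    then show ?thesis
      by (elim exE) (intro exI, rule avoiding_path_rev)
  next
    case 4
    then show ?thesis
      using avoiding_path_hanging_hanging n uw by blast
  next
    case 5
    have "u \<ge> 11 \<and> w \<ge> 11"
    proof (cases "u < 10 \<or> w < 10")
      case True
      then have "w = mate u"
        using mate_unique 5 uw(3) by metis
      then show ?thesis
        using hanging_triangle(2)[OF 5(1) uw(1) n] uw(4) by metis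
    next
      case False
      then have "u \<noteq> 10 \<and> w \<noteq> 10"
        using uw by (auto simp: adj_iff arcs_def)
      then show ?thesis
        using False by auto
    qed
    then show ?thesis
      using avoiding_path_pages n uw by blast
  qed
qed

section \<open>Bounds for \<open>rsat\<close>\<close>

lemma rsat_cycle5_upper:
  assumes n: "n \<ge> 15"
  shows "rsat n (cycle 5) \<le> 2 * n - 6"
proof -
  have G: "simple_graph (extremal_graph n)"
    using simple_extremal_graph n by simp
  have "finite (edges (extremal_graph n))"
    by (simp add: extremal_graph_def arcs_def)
  then obtain c :: "nat set \<Rightarrow> nat" where c: "inj_on c (edges (extremal_graph n))"
    using finite_imp_inj_to_nat_seg by blast
  have sat: "rainbow_saturated (cycle 5) (extremal_graph n) c"
  proof (rule rainbow_saturated_cycle5I[OF G c])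
    fix p q r s t
    assume "distinct [p, q, r, s, t]"
      "{{p,q},{q,r},{r,s},{s,t},{t,p}} \<subseteq> edges (extremal_graph n)"
    then show False
      by (intro no_pentagon[of p q r s t n]) simp_all
  next
    fix u w f
    assume "u \<in> verts (extremal_graph n)" "w \<in> verts (extremal_graph n)" "u \<noteq> w" "\<not> adj n u w"
    then obtain p q r where "avoiding_path (edges (extremal_graph n)) f u p q r w"
      using avoiding_path_nonadjacent[OF n] unfolding verts_extremal_graph by blast
    then have "distinct [u, p, q, r, w] \<and>
        {{u,p},{p,q},{q,r},{r,w}} \<subseteq> edges (extremal_graph n) - {f}"
      unfolding avoiding_path_def by auto
    then show "\<exists>p q r. distinct [u, p, q, r, w] \<and>
        {{u,p},{p,q},{q,r},{r,w}} \<subseteq> edges (extremal_graph n) - {f}"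
      by (intro exI)
  qed
  have "rsat n (cycle 5) \<le> card (edges (extremal_graph n))"
    unfolding rsat_def
    by (rule Least_le, rule exI[of _ "extremal_graph n"], rule exI[of _ c])
      (simp add: G sat verts_extremal_graph)
  also have "\<dots> \<le> 2 * n - 6"
    using card_edges_extremal_graph n by simp
  finally show ?thesis .
qed

lemma rsat_cycle5_lower:
  assumes n: "n \<ge> 3"
  shows "3 * n \<le> 2 * rsat n (cycle 5) + 5"
proof -
  \<comment> \<open>Two distinct edges of the cycle guarantee that the minimum in
    \<open>rsat\<close> is attained.\<close>
  have "{0,1} \<in> edges (cycle 5)" "{1,2} \<in> edges (cycle 5)" "{0,1::nat} \<noteq> {1,2}"
    unfolding cycle5_edges by (simp_all add: doubleton_eq_iff)
  from rsat_attained[OF this simple_graph_cycle5, of n] obtain G :: "nat graph" and c where G: "simple_graph G" "card (verts G) = n"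
    and m: "card (edges G) = rsat n (cycle 5)" and sat: "rainbow_saturated (cycle 5) G c"
    by (elim exE conjE) (rule that)
  interpret avoiding_paths "verts G" "edges G" c
  proof
    show "finite (verts G)"
      using G(1) by (simp add: simple_graph_def)
    show "a \<in> verts G \<and> b \<in> verts G \<and> a \<noteq> b" if "{a, b} \<in> edges G" for a b
      using edge_in_verts[OF G(1) that] by simp
    show "\<exists>a b. e = {a, b} \<and> a \<noteq> b" if "e \<in> edges G" for e
      using G(1) that unfolding simple_graph_def card_2_iff by blast
  next
    fix u v k
    assume "u \<in> verts G" "v \<in> verts G" "u \<noteq> v" "{u, v} \<notin> edges G"
    from rainbow_saturated_cycle5_path[OF G(1) sat this, of k]
    show "\<exists>p q r. distinct [u, p, q, r, v] \<and>
        {u,p} \<in> edges G \<and> {p,q} \<in> edges G \<and> {q,r} \<in> edges G \<and> {r,v} \<in> edges G \<and>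
        k \<noteq> c {u,p} \<and> k \<noteq> c {p,q} \<and> k \<noteq> c {q,r} \<and> k \<noteq> c {r,v}"
      by (simp only: insert_subset empty_subsetI image_insert image_empty insert_iff empty_iff
          simp_thms de_Morgan_disj conj_assoc)
  qed
  show ?thesis
    using card_edges_lower_bound n G(2) m by simp
qed

theorem theorem1p2:
  fixes n :: nat
  assumes "n \<ge> 15"
  shows "3 / 2 * real n - 5 / 2 \<le> real (rsat n (cycle 5)) \<and>
         real (rsat n (cycle 5)) \<le> 2 * real n - 6"
proof
  have "real (3 * n) \<le> real (2 * rsat n (cycle 5) + 5)"
    using rsat_cycle5_lower[of n] assms by (simp only: of_nat_le_iff)
  then show "3 / 2 * real n - 5 / 2 \<le> real (rsat n (cycle 5))"
    by simp
  \<comment> \<open>The truncated subtraction is cleared before the passage to the reals.\<close>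
  have "rsat n (cycle 5) + 6 \<le> 2 * n"
    using rsat_cycle5_upper[OF assms] assms by simp
  then have "real (rsat n (cycle 5) + 6) \<le> real (2 * n)"
    by (simp only: of_nat_le_iff)
  then show "real (rsat n (cycle 5)) \<le> 2 * real n - 6"
    by simp
qed

end
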